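(* Let $R=\mathcal{R}(d_R(t),h(t))$ and $S=\mathcal{R}(d_S(t),h(t))$ be two Riordan arrays with the same second series $h(t)$, such that $d_R(0)+d_S(0)\neq 0$, and let $d_{R+S}(t)=d_R(t)+d_S(t)$ (so $R+S=\mathcal{R}(d_{R+S}(t),h(t))$). Then $R$, $S$ and $R+S$ all have the same $A$-sequence, with generating function $A(t)=t/\bar h(t)$. Moreover, writing $Z_R,Z_S,Z_{R+S}$ for the $Z$-sequence generating functions of $R,S,R+S$, $$Z_{R+S}(t)=\frac{d_R(0)Z_R(t)+d_S(0)Z_S(t)-d_{R+S}(0)\,\bar h(t)Z_R(t)Z_S(t)}{d_{R+S}(0)-\bar h(t)d_R(0)Z_S(t)-\bar h(t)d_S(0)Z_R(t)},$$ equivalently $$Z_{R+S}(t)=\frac{[d_R(0)Z_R(t)+d_S(0)Z_S(t)]A(t)-t\,d_{R+S}(0)Z_R(t)Z_S(t)}{d_{R+S}(0)A(t)-t[d_R(0)Z_S(t)+d_S(0)Z_R(t)]};$$ also $$Z_{R+S}(h(t))=\frac{d_R(t)+d_S(t)-d_R(0)-d_S(0)}{t(d_R(t)+d_S(t))},$$ and $$Z_{R+S}(t)=\frac{d_R(\bar h(t))Z_R(t)+d_S(\bar h(t))Z_S(t)}{d_R(\bar h(t))+d_S(\bar h(t))}.$$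
   Context: For formal power series $d(t),h(t)$ with $d(0)\neq 0$, $h(0)=0$, $h'(0)\neq 0$, the Riordan array $\mathcal{R}(d(t),h(t))$ is the infinite lower triangular matrix whose $(n,k)$-entry ($n,k\ge 0$) is $[t^n]\,d(t)h(t)^k$. $\bar h(t)$ denotes the compositional inverse of $h(t)$, i.e. $h(\bar h(t))=t=\bar h(h(t))$. The $A$-sequence $(a_n)$ of $\mathcal{R}(d,h)$ is the sequence with $d_{r+1,c+1}=\sum_{i\ge 0}a_i d_{r,c+i}$ for all $r,c\ge 0$ (where $d_{n,k}$ are the entries); its generating function is $A(t)=t/\bar h(t)$. The $Z$-sequence $(z_n)$ is the sequence with $d_{r+1,0}=\sum_{i\ge0} z_i d_{r,i}$ for all $r\ge 0$; its generating function is $Z(t)=\dfrac{d(\bar h(t))-d(0)}{\bar h(t)\,d(\bar h(t))}$, equivalently $d(t)=d(0)/(1-tZ(h(t)))$. *)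

theory Defs
  imports "HOL-Computational_Algebra.Formal_Power_Series" "HOL-Library.Groups_Big_Fun"
begin

definition riordan :: "'a::field fps \<Rightarrow> 'a fps \<Rightarrow> nat \<Rightarrow> nat \<Rightarrow> 'a" where
  "riordan d h n k = fps_nth (d * h ^ k) n"

text \<open>
  The rows of a lower triangular matrix have finite support, so for Riordan arrays the
  finite-support sum \<^const>\<open>Sum_any\<close> is the sum over all \<open>i \<ge> 0\<close>.
\<close>

definition is_A_sequence :: "(nat \<Rightarrow> nat \<Rightarrow> 'a::field) \<Rightarrow> (nat \<Rightarrow> 'a) \<Rightarrow> bool" where
  "is_A_sequence M a \<longleftrightarrow>
     (\<forall>r c. M (r + 1) (c + 1) = Sum_any (\<lambda>i. a i * M r (c + i)))"

definition is_Z_sequence :: "(nat \<Rightarrow> nat \<Rightarrow> 'a::field) \<Rightarrow> (nat \<Rightarrow> 'a) \<Rightarrow> bool" where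
  "is_Z_sequence M z \<longleftrightarrow> (\<forall>r. M (r + 1) 0 = Sum_any (\<lambda>i. z i * M r i))"

text \<open>Meaningful only for matrices with exactly one \<open>Z\<close>-sequence.\<close>

definition Z_series :: "(nat \<Rightarrow> nat \<Rightarrow> 'a::field) \<Rightarrow> 'a fps" where
  "Z_series M = Abs_fps (THE z. is_Z_sequence M z)"

end

theory Submission imports Defs begin

text \<open>
  Multiplying a Riordan array by the column vector with generating function \<open>f\<close> gives the vector
  with generating function \<open>d(t) f(h(t))\<close>. Hence \<open>a\<close> is an \<open>A\<close>-sequence iff \<open>h = t a(h)\<close>,
  and \<open>z\<close> is a \<open>Z\<close>-sequence iff \<open>d - d(0) = t d z(h)\<close>; both determine the sequence, since
  composition with \<open>h\<close> is invertible. Substituting \<open>hbar\<close> turns the latter equation into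
  \<open>d(hbar) (1 - hbar Z) = d(0)\<close>. Both \<open>d(hbar)\<close> and
  \<open>d(0)\<close> are additive in \<open>d\<close>, so adding these equations for \<open>R\<close> and \<open>S\<close> gives \<open>ZRS\<close> as a weighted mean;
  eliminating \<open>dR(hbar)\<close> and \<open>dS(hbar)\<close> gives the formulas in \<open>ZR\<close> and \<open>ZS\<close> alone.
\<close>

text \<open>Since \<open>h\<close> has no constant term, \<open>h ^ i\<close> starts at degree
  \<open>i\<close> or later. So the row sum and the coefficient of the composition both stop at
  \<open>i = r\<close>, and exchanging two finite sums identifies them.\<close>

lemma Sum_any_riordan:
  fixes d h :: "'a::field fps"
  assumes h0: "fps_nth h 0 = 0"
  shows "Sum_any (\<lambda>i. a i * riordan d h r i) = fps_nth (d * (Abs_fps a oo h)) r"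
proof -
  have nth0: "fps_nth (h ^ i) m = 0" if "m < i" for i m
    using that h0 by (simp add: startsby_zero_power_prefix)
  have supp: "{i. a i * riordan d h r i \<noteq> 0} \<subseteq> {0..r}"
    by (auto simp: riordan_def fps_mult_nth nth0 intro!: sum.neutral leI)
  have inner: "fps_nth (Abs_fps a oo h) (r - k) = (\<Sum>i=0..r. a i * fps_nth (h ^ i) (r - k))" for k
    unfolding fps_compose_nth by (auto intro!: sum.mono_neutral_cong_left simp: nth0)
  have "fps_nth (d * (Abs_fps a oo h)) r
      = (\<Sum>k=0..r. \<Sum>i=0..r. a i * (fps_nth d k * fps_nth (h ^ i) (r - k)))"
    by (simp add: fps_mult_nth inner sum_distrib_left algebra_simps)
  also have "\<dots> = (\<Sum>i=0..r. a i * riordan d h r i)"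
    by (subst sum.swap) (simp add: riordan_def fps_mult_nth sum_distrib_left)
  also have "\<dots> = Sum_any (\<lambda>i. a i * riordan d h r i)"
    by (rule Sum_any.expand_superset[symmetric, OF _ supp]) simp
  finally show ?thesis by simp
qed

text \<open>Translates between a recurrence that shifts the row index and an equation of series; the
  shift never sees the constant term, hence its subtraction.\<close>

lemma fps_eq_X_mult_iff:
  fixes f g :: "'a::field fps"
  shows "f - fps_const (fps_nth f 0) = fps_X * g \<longleftrightarrow> (\<forall>r. fps_nth f (r + 1) = fps_nth g r)"
proof
  assume *: "f - fps_const (fps_nth f 0) = fps_X * g"
  show "\<forall>r. fps_nth f (r + 1) = fps_nth g r"
  proof
    fix r
    show "fps_nth f (r + 1) = fps_nth g r"
      using arg_cong[OF *, of "\<lambda>f. fps_nth f (r + 1)"] by simp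
  qed
next
  assume *: "\<forall>r. fps_nth f (r + 1) = fps_nth g r"
  show "f - fps_const (fps_nth f 0) = fps_X * g"
  proof (rule fps_ext)
    fix n
    show "fps_nth (f - fps_const (fps_nth f 0)) n = fps_nth (fps_X * g) n"
      using * by (cases n) auto
  qed
qed

lemma fps_inv_nth_0 [simp]: "fps_nth (fps_inv h) 0 = 0"
  by (simp add: fps_inv_def)

lemma fps_inv_neq_0:
  fixes h :: "'a::field fps"
  assumes "fps_nth h 0 = 0" "fps_nth h 1 \<noteq> 0"
  shows "fps_inv h \<noteq> 0"
  using fps_inv[OF assms] by auto

text \<open>Comparing linear coefficients in \<open>fps_inv h oo h = fps_X\<close> bounds the
  subdegree by 1. As \<open>fps_inv h\<close> is not a unit, this is what makes the quotient
  \<open>fps_X / fps_inv h\<close> exact.\<close>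

lemma fps_inv_dvd_X:
  fixes h :: "'a::field fps"
  assumes "fps_nth h 0 = 0" "fps_nth h 1 \<noteq> 0"
  shows "fps_inv h dvd fps_X"
proof -
  have "fps_nth (fps_inv h) 1 * fps_nth h 1 = 1"
    using arg_cong[OF fps_inv[OF assms], of "\<lambda>f. fps_nth f 1"] by (simp add: fps_compose_nth)
  then have "fps_nth (fps_inv h) 1 \<noteq> 0"
    by auto
  then have "subdegree (fps_inv h) \<le> 1"
    by (rule subdegree_leI)
  then show ?thesis
    using fps_inv_neq_0[OF assms] by (simp add: fps_dvd_iff)
qed

lemma fps_compose_eq_iff:
  fixes f g h :: "'a::field fps"
  assumes "fps_nth h 0 = 0" "fps_nth h 1 \<noteq> 0"
  shows "f oo h = g \<longleftrightarrow> f = g oo fps_inv h"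
proof
  assume "f oo h = g"
  then have "g oo fps_inv h = f oo (h oo fps_inv h)"
    using assms by (auto simp: fps_compose_assoc)
  then show "f = g oo fps_inv h"
    using fps_inv_right[OF assms] by simp
next
  assume "f = g oo fps_inv h"
  then have "f oo h = g oo (fps_inv h oo h)"
    using assms by (auto simp: fps_compose_assoc)
  then show "f oo h = g"
    using fps_inv[OF assms] by simp
qed

lemma is_A_sequence_riordan_iff:
  fixes d h :: "'a::field fps"
  assumes d0: "fps_nth d 0 \<noteq> 0" and h0: "fps_nth h 0 = 0" and h1: "fps_nth h 1 \<noteq> 0"
  shows "is_A_sequence (riordan d h) a \<longleftrightarrow> a = fps_nth (fps_X / fps_inv h)"
proof -
  \<comment> \<open>Absorbing \<open>h ^ c\<close> into the first series moves column
    \<open>c\<close> to column 0, so \<open>Sum_any_riordan\<close> applies for every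
    \<open>c\<close>.\<close>
  have shift: "riordan d h r (c + i) = riordan (d * h ^ c) h r i" for r c i
    by (simp add: riordan_def power_add mult.assoc)
  have nz: "d * h ^ c \<noteq> 0" for c
    using d0 h1 by auto
  have "is_A_sequence (riordan d h) a \<longleftrightarrow>
      (\<forall>c r. fps_nth (d * h ^ (c + 1)) (r + 1) = fps_nth (d * h ^ c * (Abs_fps a oo h)) r)"
    unfolding is_A_sequence_def shift Sum_any_riordan[OF h0]
    by (subst all_comm) (simp add: riordan_def mult_ac)
  \<comment> \<open>The left-hand series contains a factor \<open>h\<close>, so its constant term is
    0 and no correction remains.\<close>
  also have "\<dots> \<longleftrightarrow> (\<forall>c. d * h ^ (c + 1) = fps_X * (d * h ^ c * (Abs_fps a oo h)))"
    unfolding fps_eq_X_mult_iff[symmetric] using h0 by simp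
  also have "\<dots> \<longleftrightarrow> (\<forall>c. d * h ^ c * h = d * h ^ c * (fps_X * (Abs_fps a oo h)))"
    by (simp add: mult_ac)
  \<comment> \<open>Cancelling \<open>d * h ^ c\<close> leaves one and the same equation for all
    columns.\<close>
  also have "\<dots> \<longleftrightarrow> (fps_X * (Abs_fps a oo h)) = h"
    by (simp only: mult_left_cancel[OF nz]) auto
  \<comment> \<open>Writing \<open>fps_X\<close> as \<open>fps_inv h oo h\<close> brings the whole
    left side under one composition, which can then be inverted.\<close>
  also have "\<dots> \<longleftrightarrow> (fps_inv h * Abs_fps a) oo h = h"
    by (simp add: fps_compose_mult_distrib[OF h0] fps_inv[OF h0 h1])
  also have "\<dots> \<longleftrightarrow> Abs_fps a * fps_inv h = fps_X"
    by (simp add: fps_compose_eq_iff[OF h0 h1] fps_inv_right[OF h0 h1] mult.commute)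
  also have "\<dots> \<longleftrightarrow> Abs_fps a = fps_X / fps_inv h"
  proof
    assume "Abs_fps a * fps_inv h = fps_X"
    then show "Abs_fps a = fps_X / fps_inv h"
      using fps_inv_neq_0[OF h0 h1] by (metis nonzero_mult_div_cancel_right)
  next
    assume "Abs_fps a = fps_X / fps_inv h"
    then show "Abs_fps a * fps_inv h = fps_X"
      using fps_inv_dvd_X[OF h0 h1] by simp
  qed
  also have "\<dots> \<longleftrightarrow> a = fps_nth (fps_X / fps_inv h)"
    by (auto simp: fps_eq_iff fun_eq_iff)
  finally show ?thesis .
qed

lemma is_Z_sequence_riordan_iff:
  fixes d h :: "'a::field fps"
  assumes h0: "fps_nth h 0 = 0"
  shows "is_Z_sequence (riordan d h) z \<longleftrightarrow>
    d - fps_const (fps_nth d 0) = fps_X * (d * (Abs_fps z oo h))"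
  unfolding fps_eq_X_mult_iff is_Z_sequence_def Sum_any_riordan[OF h0] by (simp add: riordan_def)

lemma ex1_Z_sequence_riordan:
  fixes d h :: "'a::field fps"
  assumes d0: "fps_nth d 0 \<noteq> 0" and h0: "fps_nth h 0 = 0" and h1: "fps_nth h 1 \<noteq> 0"
  shows "\<exists>!z. is_Z_sequence (riordan d h) z"
proof -
  have d: "d \<noteq> 0" using d0 by auto
  \<comment> \<open>The series \<open>fps_shift 1 d\<close> is (d - d(0))/t, and \<open>d\<close> is
    a unit, so the quotient is the only possible value of Z(h).\<close>
  have "d * (fps_shift 1 d / d) = fps_shift 1 d"
    using d0 by (simp add: fps_divide_unit inverse_mult_eq_1' mult.left_commute)
  then have "fps_nth d (r + 1) = fps_nth (d * (fps_shift 1 d / d)) r" for r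
    by simp
  then have eq: "d - fps_const (fps_nth d 0) = fps_X * (d * (fps_shift 1 d / d))"
    by (simp add: fps_eq_X_mult_iff)
  have "is_Z_sequence (riordan d h) z \<longleftrightarrow> Abs_fps z oo h = fps_shift 1 d / d" for z
    unfolding is_Z_sequence_riordan_iff[OF h0] eq using d by auto
  then have "is_Z_sequence (riordan d h) z \<longleftrightarrow> Abs_fps z = (fps_shift 1 d / d) oo fps_inv h" for z
    by (simp add: fps_compose_eq_iff[OF h0 h1])
  then have "is_Z_sequence (riordan d h) z \<longleftrightarrow> z = fps_nth ((fps_shift 1 d / d) oo fps_inv h)" for z
    by (auto simp: fps_eq_iff fun_eq_iff)
  then show ?thesis by simp
qed

lemma
  fixes d h :: "'a::field fps"
  assumes d0: "fps_nth d 0 \<noteq> 0" and h0: "fps_nth h 0 = 0" and h1: "fps_nth h 1 \<noteq> 0"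
  shows Z_series_riordan_compose:
      "(Z_series (riordan d h) oo h) * (fps_X * d) = d - fps_const (fps_nth d 0)"
    and Z_series_riordan_inv:
      "(d oo fps_inv h) * (1 - fps_inv h * Z_series (riordan d h)) = fps_const (fps_nth d 0)"
proof -
  let ?Z = "Z_series (riordan d h)"
  have "is_Z_sequence (riordan d h) (THE z. is_Z_sequence (riordan d h) z)"
    by (rule theI'[OF ex1_Z_sequence_riordan[OF assms]])
  then have eq: "d - fps_const (fps_nth d 0) = fps_X * (d * (?Z oo h))"
    unfolding is_Z_sequence_riordan_iff[OF h0] Z_series_def .
  then show "(?Z oo h) * (fps_X * d) = d - fps_const (fps_nth d 0)"
    by (simp add: mult_ac)
  have "(?Z oo h) oo fps_inv h = ?Z"
    using fps_compose_eq_iff[OF h0 h1] by metis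
  then have "(d oo fps_inv h) - fps_const (fps_nth d 0) = fps_inv h * ((d oo fps_inv h) * ?Z)"
    using arg_cong[OF eq, of "\<lambda>f. f oo fps_inv h"]
    by (simp add: fps_compose_sub_distrib fps_compose_mult_distrib)
  then show "(d oo fps_inv h) * (1 - fps_inv h * ?Z) = fps_const (fps_nth d 0)"
    by (simp add: algebra_simps)
qed

theorem theorem3p3:
  fixes dR dS h hbar A ZR ZS ZRS :: "'a::field fps"
    and R S RS :: "nat \<Rightarrow> nat \<Rightarrow> 'a"
  assumes dR0: "fps_nth dR 0 \<noteq> 0"
    and dS0: "fps_nth dS 0 \<noteq> 0"
    and h0: "fps_nth h 0 = 0"
    and h1: "fps_nth h 1 \<noteq> 0"
    and dRS0: "fps_nth dR 0 + fps_nth dS 0 \<noteq> 0"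
  defines "R \<equiv> riordan dR h"
    and "S \<equiv> riordan dS h"
    and "RS \<equiv> (\<lambda>n k. R n k + S n k)"
    and "dRS \<equiv> dR + dS"
    and "hbar \<equiv> fps_inv h"
    and "A \<equiv> fps_X / hbar"
    and "ZR \<equiv> Z_series R"
    and "ZS \<equiv> Z_series S"
    and "ZRS \<equiv> Z_series RS"
  shows "(RS = riordan dRS h) \<and>
    (\<forall>M\<in>{R, S, RS}. \<forall>a. is_A_sequence M a \<longleftrightarrow> a = fps_nth A) \<and>
    (\<forall>M\<in>{R, S, RS}. \<exists>!z. is_Z_sequence M z) \<and>
    (ZRS =
      (fps_const (fps_nth dR 0) * ZR + fps_const (fps_nth dS 0) * ZS
         - fps_const (fps_nth dRS 0) * hbar * ZR * ZS)
      / (fps_const (fps_nth dRS 0) - hbar * fps_const (fps_nth dR 0) * ZS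
         - hbar * fps_const (fps_nth dS 0) * ZR)) \<and>
    (ZRS =
      ((fps_const (fps_nth dR 0) * ZR + fps_const (fps_nth dS 0) * ZS) * A
         - fps_X * fps_const (fps_nth dRS 0) * ZR * ZS)
      / (fps_const (fps_nth dRS 0) * A
         - fps_X * (fps_const (fps_nth dR 0) * ZS + fps_const (fps_nth dS 0) * ZR))) \<and>
    (fps_compose ZRS h =
      (dR + dS - fps_const (fps_nth dR 0) - fps_const (fps_nth dS 0))
      / (fps_X * (dR + dS))) \<and>
    (ZRS =
      (fps_compose dR hbar * ZR + fps_compose dS hbar * ZS)
      / (fps_compose dR hbar + fps_compose dS hbar))"
proof -
  define D E where "D = dR oo hbar" and "E = dS oo hbar"
  define r s where "r = fps_const (fps_nth dR 0)" and "s = fps_const (fps_nth dS 0)"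
  define q where "q = r + s - hbar * r * ZS - hbar * s * ZR"
  have RS: "RS = riordan dRS h"
    by (simp add: RS_def R_def S_def dRS_def riordan_def fun_eq_iff distrib_right)
  have dRS_nz: "fps_nth dRS 0 \<noteq> 0"
    using dRS0 by (simp add: dRS_def)
  have rs: "fps_const (fps_nth dRS 0) = r + s"
    by (simp add: r_def s_def dRS_def)
  have hbar_nz: "hbar \<noteq> 0" and hbar_0: "fps_nth hbar 0 = 0"
    unfolding hbar_def using fps_inv_neq_0[OF h0 h1] by simp_all
  have ZR: "D * (1 - hbar * ZR) = r"
    unfolding D_def ZR_def R_def hbar_def r_def by (rule Z_series_riordan_inv[OF dR0 h0 h1])
  have ZS: "E * (1 - hbar * ZS) = s"
    unfolding E_def ZS_def S_def hbar_def s_def by (rule Z_series_riordan_inv[OF dS0 h0 h1])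
  have ZRS: "(D + E) * (1 - hbar * ZRS) = r + s"
    using Z_series_riordan_inv[OF dRS_nz h0 h1]
    unfolding rs by (simp add: D_def E_def ZRS_def RS hbar_def dRS_def fps_compose_add_distrib)
  have D_nz: "D \<noteq> 0" and E_nz: "E \<noteq> 0"
    using ZR ZS dR0 dS0 by (auto simp: r_def s_def)
  have DE_nz: "D + E \<noteq> 0"
    using ZRS dRS_nz by (auto simp flip: rs)
  \<comment> \<open>At t = 0 the terms with \<open>hbar\<close> vanish, leaving
    \<open>dR(0) + dS(0)\<close>.\<close>
  have q_nz: "q \<noteq> 0"
  proof -
    have "fps_nth q 0 \<noteq> 0"
      using dRS0 by (simp add: q_def r_def s_def hbar_0)
    then show ?thesis by auto
  qed
  have weighted: "ZRS * (D + E) = D * ZR + E * ZS"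
  proof -
    \<comment> \<open>Each of the three equations determines only \<open>hbar\<close> times a
      product, so the identity is shown after multiplication by \<open>hbar\<close>, which cancels
      in an integral domain.\<close>
    have "hbar * (ZRS * (D + E)) = (D + E) - (D + E) * (1 - hbar * ZRS)"
      by (simp add: algebra_simps)
    also have "\<dots> = (D + E) - (D * (1 - hbar * ZR) + E * (1 - hbar * ZS))"
      by (simp only: ZR ZS ZRS)
    also have "\<dots> = hbar * (D * ZR + E * ZS)"
      by (simp add: algebra_simps)
    finally show ?thesis using hbar_nz by simp
  qed
  have num: "ZRS * q = r * ZR + s * ZS - (r + s) * hbar * ZR * ZS"
  proof -
    \<comment> \<open>Since \<open>q = r * (1 - hbar * ZS) + s * (1 - hbar * ZR)\<close>, the factor
      \<open>D * E\<close> turns it into \<open>r * s * (D + E)\<close>, to which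
      \<open>weighted\<close> applies. Replacing \<open>s\<close> and \<open>r\<close> by their
      products again then exposes \<open>D * E\<close> for cancellation.\<close>
    have "D * E * (ZRS * q)
        = ZRS * (r * D * (E * (1 - hbar * ZS)) + s * E * (D * (1 - hbar * ZR)))"
      by (simp add: q_def algebra_simps)
    also have "\<dots> = r * s * (ZRS * (D + E))"
      unfolding ZR ZS by (simp add: algebra_simps)
    also have "\<dots> = D * r * ZR * s + E * s * ZS * r"
      unfolding weighted by (simp add: algebra_simps)
    also have "\<dots> = D * r * ZR * (E * (1 - hbar * ZS)) + E * s * ZS * (D * (1 - hbar * ZR))"
      by (simp only: ZR ZS)
    also have "\<dots> = D * E * (r * ZR + s * ZS - (r + s) * hbar * ZR * ZS)"
      by (simp add: algebra_simps)
    finally have "D * E * (ZRS * q) = D * E * (r * ZR + s * ZS - (r + s) * hbar * ZR * ZS)" .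
    then show ?thesis using D_nz E_nz by simp
  qed
  have A_sequence: "is_A_sequence M a \<longleftrightarrow> a = fps_nth A" if "M \<in> {R, S, RS}" for M a
    using that is_A_sequence_riordan_iff[OF _ h0 h1] dR0 dS0 dRS_nz
    unfolding RS unfolding R_def S_def A_def hbar_def by blast
  have Z_sequence: "\<exists>!z. is_Z_sequence M z" if "M \<in> {R, S, RS}" for M
    using that ex1_Z_sequence_riordan[OF _ h0 h1] dR0 dS0 dRS_nz
    unfolding RS unfolding R_def S_def by blast
  have A: "A * hbar = fps_X"
    using fps_inv_dvd_X[OF h0 h1] by (simp add: A_def hbar_def)
  have A_nz: "A \<noteq> 0"
    using A by auto
  have "ZRS = (r * ZR + s * ZS - (r + s) * hbar * ZR * ZS) / q"
    using q_nz by (simp flip: num)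
  moreover have "ZRS = ((r * ZR + s * ZS) * A - fps_X * (r + s) * ZR * ZS)
      / ((r + s) * A - fps_X * (r * ZS + s * ZR))"
  proof -
    \<comment> \<open>The second fraction is the first one expanded by \<open>A\<close>, because
      \<open>A * hbar = fps_X\<close>.\<close>
    have "(r + s) * A - fps_X * (r * ZS + s * ZR) = q * A"
      by (simp add: q_def algebra_simps flip: A)
    moreover have "(r * ZR + s * ZS) * A - fps_X * (r + s) * ZR * ZS = ZRS * q * A"
      unfolding num by (simp add: algebra_simps flip: A)
    ultimately show ?thesis using q_nz A_nz by (simp add: mult.assoc)
  qed
  moreover have "ZRS oo h = (dR + dS - r - s) / (fps_X * (dR + dS))"
  proof -
    have "(ZRS oo h) * (fps_X * (dR + dS)) = dR + dS - r - s"
      using Z_series_riordan_compose[OF dRS_nz h0 h1]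
      unfolding rs by (simp add: ZRS_def RS dRS_def diff_diff_eq)
    moreover have "dRS \<noteq> 0"
      using dRS_nz by auto
    then have "fps_X * (dR + dS) \<noteq> 0"
      by (simp add: dRS_def)
    ultimately show ?thesis by (metis nonzero_mult_div_cancel_right)
  qed
  moreover have "ZRS = (D * ZR + E * ZS) / (D + E)"
    using DE_nz by (simp flip: weighted)
  ultimately show ?thesis
    using RS A_sequence Z_sequence
    unfolding rs q_def D_def E_def r_def[symmetric] s_def[symmetric] by blast
qed

end
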